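(* Let $p$ be an odd prime and $a,b\in\mathbb Z_p$ with $ab\not\equiv 0\pmod p$ and $\langle b\rangle_p\le p-1-\langle a\rangle_p$. Let $t=(a-\langle a\rangle_p)/p$ and $s=(b-\langle b\rangle_p)/p$, and assume $s\not\equiv -1\pmod p$. If $\langle b\rangle_p\le \langle a\rangle_p$, then $$\sum_{k=0}^{p-1}\binom ak\binom{-1-a}k\frac 1{k+b}\equiv \frac{p(s+t+1)(s-t)}{b^2(s+1)\binom{\langle a\rangle_p}{\langle b\rangle_p}\binom{p-1-\langle a\rangle_p}{\langle b\rangle_p}}\pmod{p^2}.$$ If $\langle b\rangle_p>\langle a\rangle_p$, then $$\sum_{k=0}^{p-1}\binom ak\binom{-1-a}k\frac 1{k+b}\equiv \frac{s+1+t}{b(s+1)}\cdot\frac{\binom{\langle b\rangle_p-1}{\langle a\rangle_p}}{\binom{p-1-\langle b\rangle_p}{\langle a\rangle_p}}\Big(1+p\frac{s+1}b+p(2s+1)H_{\langle b\rangle_p-1}-p(s-t)H_{\langle b\rangle_p-\langle a\rangle_p-1}-p(s+t+1)H_{\langle a\rangle_p+\langle b\rangle_p}\Big)\pmod{p^2}.$$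
   Context: $\mathbb Z_p$ denotes the set of rational numbers whose denominator is not divisible by $p$; congruences are taken in this ring. For $a\in\mathbb Z_p$, $\langle a\rangle_p\in\{0,1,\dots,p-1\}$ is defined by $a\equiv\langle a\rangle_p\pmod p$. $\binom xk=x(x-1)\cdots(x-k+1)/k!$ for rational $x$. $H_0=0$ and $H_n=1+\frac12+\cdots+\frac1n$. *)

theory Defs
  imports Complex_Main "HOL-Computational_Algebra.Primes"
begin

definition Zp :: "nat \<Rightarrow> rat set" where
  "Zp p = {x. \<not> int p dvd snd (quotient_of x)}"

text \<open>Congruence in the ring \<open>Zp p\<close>: both sides are required to lie in the ring, and the
  difference to lie in the ideal of \<open>Zp p\<close> generated by \<open>m\<close>.\<close>
definition zp_cong :: "nat \<Rightarrow> nat \<Rightarrow> rat \<Rightarrow> rat \<Rightarrow> bool" where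
  "zp_cong p m x y \<longleftrightarrow> x \<in> Zp p \<and> y \<in> Zp p \<and> (\<exists>z\<in>Zp p. x - y = of_nat m * z)"

text \<open>For \<open>p\<close> prime and \<open>a \<in> Zp p\<close> such an \<open>r\<close> exists and is unique; otherwise the value of
  \<open>zp_residue p a\<close> has no meaning.\<close>
definition zp_residue :: "nat \<Rightarrow> rat \<Rightarrow> nat" where
  "zp_residue p a = (THE r. r < p \<and> zp_cong p p a (of_nat r))"

text \<open>The library's \<open>harm\<close> lives in real normed fields, hence is not available on \<open>rat\<close>.\<close>
definition harmonic :: "nat \<Rightarrow> rat" where
  "harmonic n = (\<Sum>k=1..n. 1 / of_nat k)"

end

theory Submission
  imports Defs "HOL-Number_Theory.Cong"
begin

text \<open>
  Let \<open>F(x)\<close> be the sum with \<open>x\<close> in place of \<open>a\<close>. Over any field of characteristic \<open>0\<close> it satisfies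
  \<open>(x + b) F(x) = (x - b) F(x - 1) + 2 C(x-1, p-1) C(-1-x, p-1)\<close>, and the last term vanishes modulo
  \<open>p^2\<close> as long as \<open>x\<close> is not divisible by \<open>p\<close>. Iterating from \<open>a = A + p t\<close> down to \<open>p t\<close> gives
  \<open>F(a) = F(p t) \<Prod>(i + p t - b) / (i + p t + b)\<close> modulo \<open>p^2\<close>, the product running over \<open>1 \<le> i \<le> A\<close>.
  In \<open>F(p t)\<close> all terms except \<open>k = 0\<close> and \<open>k = p - B\<close> carry a factor \<open>p\<close> and only contribute
  \<open>\<Sum> 1/(k (k + b))\<close> modulo \<open>p\<close>; the result is \<open>(1 + s + t) (1 - p t/b) / (b (1 + s))\<close>.
  If \<open>B \<le> A\<close>, the factor \<open>i = B\<close> of the product is \<open>p (t - s)\<close>, and the others are needed only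
  modulo \<open>p\<close>. If \<open>B > A\<close>, all factors are units and a first-order expansion in \<open>p\<close> produces
  the harmonic numbers.
\<close>

section \<open>Arithmetic of p-integral rationals\<close>

text \<open>The reduced denominator divides every other denominator of the same number, so any
  fraction with denominator prime to \<open>p\<close> is a witness. Closure under the ring
  operations then needs no reduction to lowest terms.\<close>

lemma Zp_iff:
  assumes "prime p"
  shows "x \<in> Zp p \<longleftrightarrow> (\<exists>n d. \<not> int p dvd d \<and> x = of_int n / of_int d)"
proof
  assume "x \<in> Zp p"
  moreover have "x = of_int (fst (quotient_of x)) / of_int (snd (quotient_of x))"
    by (rule quotient_of_div) simp
  ultimately show "\<exists>n d. \<not> int p dvd d \<and> x = of_int n / of_int d"
    unfolding Zp_def by blast
next
  assume "\<exists>n d. \<not> int p dvd d \<and> x = of_int n / of_int d"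
  then obtain n d where d: "\<not> int p dvd d" and x: "x = of_int n / of_int d" by blast
  have d0: "d \<noteq> 0" using d by auto
  obtain n' d' where q: "quotient_of x = (n', d')" by force
  have d'0: "d' > 0" using quotient_of_denom_pos[OF q] .
  have "x = of_int n' / of_int d'" using quotient_of_div[OF q] .
  with x d0 d'0 have "(of_int (n * d') :: rat) = of_int (n' * d)"
    by (simp add: field_simps)
  hence e: "n * d' = n' * d" by (simp only: of_int_eq_iff)
  have "coprime n' d'" using quotient_of_coprime[OF q] .
  moreover have "d' dvd n' * d" by (metis e dvd_triv_right)
  ultimately have "d' dvd d" by (simp add: coprime_commute coprime_dvd_mult_right_iff)
  hence "\<not> int p dvd d'" using d dvd_trans by blast
  thus "x \<in> Zp p" by (simp add: Zp_def q)
qed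

text \<open>Because \<open>inverse 0 = 0\<close>, zero has to be excluded explicitly.\<close>

definition zp_unit :: "nat \<Rightarrow> rat \<Rightarrow> bool" where
  "zp_unit p u \<longleftrightarrow> u \<noteq> 0 \<and> u \<in> Zp p \<and> inverse u \<in> Zp p"

text \<open>Unlike \<open>zp_cong\<close>, this does not require the two sides to be \<open>p\<close>-integral.\<close>

definition pcong :: "nat \<Rightarrow> nat \<Rightarrow> rat \<Rightarrow> rat \<Rightarrow> bool" where
  "pcong p n x y \<longleftrightarrow> (\<exists>z\<in>Zp p. x - y = of_nat p ^ n * z)"

locale padic_integers =
  fixes p :: nat
  assumes p: "prime p"
begin

lemma Zp_int [simp]: "of_int n \<in> Zp p"
proof -
  have "\<not> int p dvd 1" using p by (simp add: prime_nat_iff)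
  moreover have "(of_int n :: rat) = of_int n / of_int 1" by simp
  ultimately show ?thesis using Zp_iff[OF p] by blast
qed

lemma Zp_nat [simp]: "of_nat n \<in> Zp p"
  using Zp_int[of "int n"] by simp

lemma Zp_0 [simp]: "0 \<in> Zp p" and Zp_1 [simp]: "1 \<in> Zp p"
  and Zp_numeral [simp]: "numeral k \<in> Zp p"
  using Zp_nat[of 0] Zp_nat[of 1] Zp_nat[of "numeral k"] by simp_all

lemma Zp_mult [simp, intro]:
  assumes "x \<in> Zp p" "y \<in> Zp p" shows "x * y \<in> Zp p"
proof -
  obtain n d n' d' where *: "\<not> int p dvd d" "x = of_int n / of_int d"
    "\<not> int p dvd d'" "y = of_int n' / of_int d'"
    using assms by (auto simp: Zp_iff[OF p])
  have "\<not> int p dvd d * d'" using * p by (simp add: prime_dvd_mult_iff)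
  moreover have "x * y = of_int (n * n') / of_int (d * d')" by (simp add: *)
  ultimately show ?thesis by (auto simp only: Zp_iff[OF p])
qed

lemma Zp_add [simp, intro]:
  assumes "x \<in> Zp p" "y \<in> Zp p" shows "x + y \<in> Zp p"
proof -
  obtain n d n' d' where *: "\<not> int p dvd d" "x = of_int n / of_int d"
    "\<not> int p dvd d'" "y = of_int n' / of_int d'"
    using assms by (auto simp: Zp_iff[OF p])
  have "\<not> int p dvd d * d'" using * p by (simp add: prime_dvd_mult_iff)
  moreover have "d \<noteq> 0" "d' \<noteq> 0" using * by auto
  hence "x + y = of_int (n * d' + n' * d) / of_int (d * d')" by (simp add: * field_simps)
  ultimately show ?thesis by (auto simp only: Zp_iff[OF p])
qed

lemma Zp_uminus [simp, intro]: "x \<in> Zp p \<Longrightarrow> - x \<in> Zp p"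
  using Zp_mult[of "-1" x] Zp_int[of "-1"] by simp

lemma Zp_diff [simp, intro]: "x \<in> Zp p \<Longrightarrow> y \<in> Zp p \<Longrightarrow> x - y \<in> Zp p"
  using Zp_add[of x "- y"] by simp

lemma Zp_power [simp, intro]: "x \<in> Zp p \<Longrightarrow> x ^ n \<in> Zp p"
  by (induction n) auto

lemma Zp_sum [intro]: "(\<And>i. i \<in> I \<Longrightarrow> f i \<in> Zp p) \<Longrightarrow> sum f I \<in> Zp p"
  by (induction I rule: infinite_finite_induct) auto

lemma Zp_prod [intro]: "(\<And>i. i \<in> I \<Longrightarrow> f i \<in> Zp p) \<Longrightarrow> prod f I \<in> Zp p"
  by (induction I rule: infinite_finite_induct) auto

section \<open>Units of the ring \<open>Zp p\<close>\<close>

lemma zp_unit_Zp: "zp_unit p u \<Longrightarrow> u \<in> Zp p"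
  and zp_unit_nonzero: "zp_unit p u \<Longrightarrow> u \<noteq> 0"
  by (auto simp: zp_unit_def)

lemma zp_unit_1: "zp_unit p 1" by (simp add: zp_unit_def)

lemma zp_unit_mult: "zp_unit p u \<Longrightarrow> zp_unit p v \<Longrightarrow> zp_unit p (u * v)"
  by (auto simp: zp_unit_def)

lemma zp_unit_uminus: "zp_unit p u \<Longrightarrow> zp_unit p (- u)"
  by (auto simp: zp_unit_def)

lemma zp_unit_inverse: "zp_unit p u \<Longrightarrow> zp_unit p (inverse u)"
  by (auto simp: zp_unit_def)

lemma zp_unit_divide: "zp_unit p u \<Longrightarrow> zp_unit p v \<Longrightarrow> zp_unit p (u / v)"
  by (auto simp: divide_inverse intro: zp_unit_mult zp_unit_inverse)

lemma zp_unit_prod: "(\<And>i. i \<in> I \<Longrightarrow> zp_unit p (f i)) \<Longrightarrow> zp_unit p (prod f I)"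
  by (induction I rule: infinite_finite_induct) (auto intro: zp_unit_1 zp_unit_mult)

lemma Zp_divide [intro]: "x \<in> Zp p \<Longrightarrow> zp_unit p u \<Longrightarrow> x / u \<in> Zp p"
  by (auto simp: divide_inverse zp_unit_def)

text \<open>\<open>Zp p\<close> is a local ring with maximal ideal generated by \<open>p\<close>: a
  fraction with denominator prime to \<open>p\<close> is invertible exactly when its numerator is
  prime to \<open>p\<close> too.\<close>

lemma zp_unit_iff: "zp_unit p u \<longleftrightarrow> u \<in> Zp p \<and> \<not> pcong p 1 u 0"
proof
  assume u: "zp_unit p u"
  have "\<not> pcong p 1 u 0"
  proof
    assume "pcong p 1 u 0"
    then obtain z where z: "z \<in> Zp p" "u = of_nat p * z" by (auto simp: pcong_def)
    have 1: "of_nat p * (z * inverse u) = 1"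
      using u z by (simp add: zp_unit_def field_simps)
    have "z * inverse u \<in> Zp p" using z u by (auto simp: zp_unit_def)
    then obtain n d where nd: "\<not> int p dvd d" "z * inverse u = of_int n / of_int d"
      using Zp_iff[OF p] by blast
    have "d \<noteq> 0" using nd by auto
    with 1[unfolded nd(2)] have "(of_int (int p * n) :: rat) = of_int d"
      by (simp add: divide_eq_1_iff)
    hence "int p * n = d" by (simp only: of_int_eq_iff)
    thus False using nd by auto
  qed
  thus "u \<in> Zp p \<and> \<not> pcong p 1 u 0" using u by (simp add: zp_unit_def)
next
  assume u: "u \<in> Zp p \<and> \<not> pcong p 1 u 0"
  then obtain n d where nd: "\<not> int p dvd d" "u = of_int n / of_int d"
    by (auto simp: Zp_iff[OF p])
  have "\<not> int p dvd n"
  proof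
    assume "int p dvd n"
    then obtain m where "n = int p * m" by auto
    hence "u - 0 = of_nat p ^ 1 * (of_int m / of_int d)" using nd by simp
    moreover have "of_int m / of_int d \<in> Zp p" using nd Zp_iff[OF p] by blast
    ultimately show False using u by (auto simp: pcong_def)
  qed
  moreover have "inverse u = of_int d / of_int n" using nd by simp
  ultimately have "inverse u \<in> Zp p" using Zp_iff[OF p] by blast
  moreover have "u \<noteq> 0" using nd \<open>\<not> int p dvd n\<close> by auto
  ultimately show "zp_unit p u" using u by (simp add: zp_unit_def)
qed

lemma zp_unit_nat: "\<not> p dvd n \<Longrightarrow> zp_unit p (of_nat n)"
proof -
  assume "\<not> p dvd n"
  moreover have "inverse (of_nat n) = (of_int 1 / of_int (int n) :: rat)"
    by (simp add: field_simps)
  ultimately have "inverse (of_nat n) \<in> Zp p"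
    using Zp_iff[OF p] by (metis int_dvd_int_iff)
  thus ?thesis using \<open>\<not> p dvd n\<close> by (cases "n = 0") (simp_all add: zp_unit_def)
qed

lemma zp_unit_nat_less: "0 < n \<Longrightarrow> n < p \<Longrightarrow> zp_unit p (of_nat n)"
  by (rule zp_unit_nat) (simp add: nat_dvd_not_less)

lemma zp_unit_fact: "n < p \<Longrightarrow> zp_unit p (fact n)"
proof (induction n)
  case 0 thus ?case using zp_unit_1 by simp
next
  case (Suc n)
  have "zp_unit p (of_nat (Suc n) * fact n)"
    by (rule zp_unit_mult, rule zp_unit_nat_less) (use Suc in auto)
  thus ?case by simp
qed

section \<open>Congruences modulo powers of \<open>p\<close>\<close>

lemma pcong_refl [simp]: "pcong p n x x"
  by (auto simp: pcong_def intro!: bexI[of _ 0])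

lemma pcongI: "x - y = of_nat p ^ n * z \<Longrightarrow> z \<in> Zp p \<Longrightarrow> pcong p n x y"
  by (auto simp: pcong_def)

lemma pcong_sym: "pcong p n x y \<Longrightarrow> pcong p n y x"
  unfolding pcong_def by (auto intro!: bexI[of _ "- z" for z] simp: algebra_simps)

lemma pcong_add: "pcong p n x y \<Longrightarrow> pcong p n x' y' \<Longrightarrow> pcong p n (x + x') (y + y')"
  unfolding pcong_def by (auto intro!: bexI[of _ "z + z'" for z z'] simp: algebra_simps)

lemma pcong_trans [trans]: "pcong p n x y \<Longrightarrow> pcong p n y z \<Longrightarrow> pcong p n x z"
  using pcong_add[of n x y y z] unfolding pcong_def by simp

lemma pcong_minus: "pcong p n x y \<Longrightarrow> pcong p n (- x) (- y)"
  unfolding pcong_def by (auto intro!: bexI[of _ "- z" for z] simp: algebra_simps)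

lemma pcong_diff: "pcong p n x y \<Longrightarrow> pcong p n x' y' \<Longrightarrow> pcong p n (x - x') (y - y')"
  using pcong_add[OF _ pcong_minus, of n x y x' y'] by simp

lemma pcong_scale: "pcong p n x y \<Longrightarrow> c \<in> Zp p \<Longrightarrow> pcong p n (c * x) (c * y)"
proof -
  assume "pcong p n x y" and c: "c \<in> Zp p"
  then obtain z where z: "z \<in> Zp p" "x - y = of_nat p ^ n * z" unfolding pcong_def by blast
  have "c * x - c * y = c * (x - y)" by (simp add: algebra_simps)
  also have "\<dots> = of_nat p ^ n * (c * z)" by (simp add: z)
  finally show ?thesis using z c unfolding pcong_def by blast
qed

text \<open>The difference of the products is \<open>x' * (x - y) + y * (x' - y')\<close>, so
  integrality is asked only of the two multipliers \<open>x'\<close> and \<open>y\<close>.\<close>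

lemma pcong_mult:
  assumes "pcong p n x y" "pcong p n x' y'" "x' \<in> Zp p" "y \<in> Zp p"
  shows "pcong p n (x * x') (y * y')"
proof -
  have "pcong p n (x' * x) (x' * y)" using assms by (intro pcong_scale)
  moreover have "pcong p n (y * x') (y * y')" using assms by (intro pcong_scale)
  ultimately show ?thesis using pcong_trans by (simp add: mult.commute)
qed

lemma pcong_p_mult: "pcong p n x y \<Longrightarrow> pcong p (Suc n) (of_nat p * x) (of_nat p * y)"
  unfolding pcong_def by (auto simp: algebra_simps)

lemma pcong_Suc_imp: "pcong p (Suc n) x y \<Longrightarrow> pcong p n x y"
  unfolding pcong_def
proof (elim bexE)
  fix z assume "z \<in> Zp p" "x - y = of_nat p ^ Suc n * z"
  thus "\<exists>z\<in>Zp p. x - y = of_nat p ^ n * z"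
    by (intro bexI[of _ "of_nat p * z"]) auto
qed

lemma pcong_Zp: "pcong p n x y \<Longrightarrow> y \<in> Zp p \<Longrightarrow> x \<in> Zp p"
proof -
  assume "pcong p n x y" and y: "y \<in> Zp p"
  then obtain z where z: "z \<in> Zp p" "x - y = of_nat p ^ n * z" unfolding pcong_def by blast
  have "x = y + of_nat p ^ n * z" using z by (simp add: algebra_simps)
  moreover have "y + of_nat p ^ n * z \<in> Zp p" using z y by auto
  ultimately show ?thesis by simp
qed

lemma pcong_1_unit: "pcong p 1 u v \<Longrightarrow> zp_unit p v \<Longrightarrow> zp_unit p u"
  unfolding zp_unit_iff using pcong_Zp pcong_sym pcong_trans by blast

lemma pcong_cancel:
  assumes "pcong p n (u * x) (u * y)" "zp_unit p u"
  shows "pcong p n x y"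
  using pcong_scale[OF assms(1), of "inverse u"] assms(2)
  by (simp add: zp_unit_def flip: mult.assoc)

lemma pcong_inverse:
  assumes "pcong p n u v" "zp_unit p u" "zp_unit p v"
  shows "pcong p n (1 / u) (1 / v)"
proof (rule pcong_cancel[OF _ zp_unit_mult[OF assms(2,3)]])
  show "pcong p n (u * v * (1 / u)) (u * v * (1 / v))"
    using pcong_sym[OF assms(1)] assms(2,3) by (simp add: zp_unit_def)
qed

lemma pcong_sum: "(\<And>i. i \<in> I \<Longrightarrow> pcong p n (f i) (g i)) \<Longrightarrow> pcong p n (sum f I) (sum g I)"
  by (induction I rule: infinite_finite_induct) (auto intro: pcong_add)

lemma pcong_prod:
  assumes "\<And>i. i \<in> I \<Longrightarrow> pcong p n (f i) (g i)" "\<And>i. i \<in> I \<Longrightarrow> g i \<in> Zp p"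
  shows "pcong p n (prod f I) (prod g I)"
  using assms
  by (induction I rule: infinite_finite_induct)
     (auto intro!: pcong_mult Zp_prod intro: pcong_Zp)

text \<open>Integrality passes from one side of a congruence to the other, so checking it for
  \<open>y\<close> alone suffices.\<close>

lemma zp_cong_iff: "zp_cong p (p ^ n) x y \<longleftrightarrow> pcong p n x y \<and> y \<in> Zp p"
  unfolding zp_cong_def pcong_def
  using pcong_Zp[unfolded pcong_def, of x y n] by auto

text \<open>Existence comes from inverting the denominator modulo \<open>p\<close>. Uniqueness,
  which gives the definite description its meaning, holds because the difference of two distinct
  candidates below \<open>p\<close> is a unit.\<close>

lemma zp_residue_props:
  assumes "a \<in> Zp p"
  shows "zp_residue p a < p" "pcong p 1 a (of_nat (zp_residue p a))"
proof -
  obtain n d where nd: "\<not> int p dvd d" "a = of_int n / of_int d"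
    using assms by (auto simp: Zp_iff[OF p])
  have "coprime d (int p)" using nd p
    by (metis prime_imp_coprime coprime_commute prime_nat_int_transfer)
  then obtain e where e: "[d * e = 1] (mod int p)" using cong_solve_coprime_int by blast
  define r where "r = nat ((n * e) mod int p)"
  have p0: "int p > 0" using p prime_gt_0_nat by auto
  have r: "int r = (n * e) mod int p" using p0 by (simp add: r_def)
  have "[n - d * int r = n - d * (n * e)] (mod int p)"
    unfolding r by (intro cong_diff cong_mult) (auto simp: cong_def)
  also have "n - d * (n * e) = n - n * (d * e)" by simp
  also have "[n - n * (d * e) = n - n * 1] (mod int p)" using e by (intro cong_diff cong_mult) auto
  finally have "int p dvd n - d * int r" by (simp add: cong_0_iff)
  then obtain m where m: "n - d * int r = int p * m" by blast
  have d0: "d \<noteq> 0" using nd by auto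
  have "n = d * int r + int p * m" using m by simp
  hence "a - of_nat r = of_nat p ^ 1 * (of_int m / of_int d)"
    using d0 by (simp add: nd field_simps)
  moreover have "of_int m / of_int d \<in> Zp p" using nd Zp_iff[OF p] by blast
  ultimately have pr: "pcong p 1 a (of_nat r)" unfolding pcong_def by blast
  have rp: "r < p" using p0 r by (metis of_nat_less_iff pos_mod_bound)
  have ar: "zp_cong p p a (of_nat r)" using zp_cong_iff[of 1] pr by simp
  have uniq: "r' = r" if "r' < p \<and> zp_cong p p a (of_nat r')" for r'
  proof (rule ccontr)
    assume ne: "r' \<noteq> r"
    have "pcong p 1 a (of_nat r')" using zp_cong_iff[of 1] that by simp
    hence c: "pcong p 1 (of_nat r) (of_nat r')" using pr pcong_sym pcong_trans by blast
    hence "pcong p 1 (of_nat r - of_nat r') 0" "pcong p 1 (of_nat r' - of_nat r) 0"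
      using pcong_diff[OF c pcong_refl, of "of_nat r'"]
        pcong_diff[OF pcong_sym[OF c] pcong_refl, of "of_nat r"] by simp_all
    moreover have "zp_unit p (of_nat (r - r'))" if "r' < r"
      using that rp by (intro zp_unit_nat_less) auto
    moreover have "zp_unit p (of_nat (r' - r))" if "r < r'"
      using that \<open>r' < p \<and> _\<close> by (intro zp_unit_nat_less) auto
    ultimately show False using ne
      by (cases "r < r'") (auto simp: zp_unit_iff of_nat_diff)
  qed
  have "zp_residue p a = r" unfolding zp_residue_def
    by (rule the_equality) (use ar rp uniq in blast)+
  thus "zp_residue p a < p" "pcong p 1 a (of_nat (zp_residue p a))" using rp pr by simp_all
qed

end

section \<open>A recurrence for the binomial sum\<close>

text \<open>The sum telescopes: each summand is the increment of the right-hand side. For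
  \<open>n = p - 1\<close> the closed form is the inhomogeneous term of the recurrence for the sum
  with denominators.\<close>

lemma gchoose_mult_partial_sum:
  fixes a :: "'a :: field_char_0"
  shows "(\<Sum>k=0..n. (a gchoose k) * ((- 1 - a) gchoose k)
            + ((a - 1) gchoose k) * ((- a) gchoose k))
         = 2 * ((a - 1) gchoose n) * ((- 1 - a) gchoose n)"
proof (induction n)
  case (Suc n)
  \<comment> \<open>The first form lowers the upper argument, the second keeps it. Together they
    express all four binomials with lower index \<open>Suc n\<close> through \<open>P\<close> and
    \<open>Q\<close>.\<close>
  have step: "(x gchoose Suc k) = x / of_nat (Suc k) * ((x - 1) gchoose k)"
    "(x gchoose Suc k) = (x - of_nat k) / of_nat (Suc k) * (x gchoose k)" for x :: 'a and k
    using gbinomial_absorption[of k x] gbinomial_mult_1[of x k]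
    by (simp_all add: nonzero_eq_divide_eq algebra_simps del: of_nat_Suc)
  define P Q where "P = (a - 1) gchoose n" and "Q = (- 1 - a) gchoose n"
  define N :: 'a where "N = of_nat (Suc n)"
  have N: "N \<noteq> 0" "of_nat n = N - 1"
    unfolding N_def by (rule of_nat_neq_0) simp
  have "(a gchoose Suc n) = a / N * P"
    "((- 1 - a) gchoose Suc n) = (- a - N) / N * Q"
    "((a - 1) gchoose Suc n) = (a - N) / N * P"
    "((- a) gchoose Suc n) = - a / N * Q"
    using step(1)[of a n] step(2)[of "- 1 - a" n] step(2)[of "a - 1" n] step(1)[of "- a" n]
    by (simp_all add: P_def Q_def N minus_diff_commute flip: N_def)
  thus ?case using Suc N(1)
    by (simp flip: P_def Q_def) (simp add: field_simps)
qed simp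

text \<open>Writing \<open>b = (b + k) - k\<close> in the \<open>k\<close>-th summand, the parts that keep the denominator
  cancel by absorption.\<close>

lemma gchoose_mult_sum_recurrence:
  fixes a b :: "'a :: field_char_0"
  assumes "\<And>k. k \<le> n \<Longrightarrow> of_nat k + b \<noteq> 0"
  defines "F \<equiv> \<lambda>a. \<Sum>k=0..n. (a gchoose k) * ((- 1 - a) gchoose k) * (1 / (of_nat k + b))"
  shows "(a + b) * F a = (a - b) * F (a - 1) + 2 * ((a - 1) gchoose n) * ((- 1 - a) gchoose n)"
proof -
  have "(a + b) * ((a gchoose k) * ((- 1 - a) gchoose k) * (1 / (of_nat k + b)))
      - (a - b) * (((a - 1) gchoose k) * ((- 1 - (a - 1)) gchoose k) * (1 / (of_nat k + b)))
      = (a gchoose k) * ((- 1 - a) gchoose k) + ((a - 1) gchoose k) * ((- a) gchoose k)"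
    if "k \<le> n" for k
  proof -
    define x y u v where "x = a gchoose k" and "y = (- 1 - a) gchoose k"
      and "u = (a - 1) gchoose k" and "v = (- a) gchoose k"
    have 1: "(a - of_nat k) * x = a * u" and 2: "(- a - of_nat k) * v = - a * y"
      using gbinomial_absorb_comp[of a k] gbinomial_absorb_comp[of "- a" k]
      by (simp_all add: x_def y_def u_def v_def minus_diff_commute)
    \<comment> \<open>Both relations lead to \<open>a * u * y\<close>, so
      \<open>(a - k) * x * y = (a + k) * u * v\<close>; this is the cancellation.\<close>
    have "(a + b) * (x * y) - (a - b) * (u * v) = (of_nat k + b) * (x * y + u * v)"
      using 1 2 by algebra
    thus ?thesis using assms(1)[OF that]
      by (simp add: x_def y_def u_def v_def divide_simps)
  qed
  hence "(a + b) * F a - (a - b) * F (a - 1)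
      = (\<Sum>k=0..n. (a gchoose k) * ((- 1 - a) gchoose k) + ((a - 1) gchoose k) * ((- a) gchoose k))"
    unfolding F_def sum_distrib_left sum_subtractf[symmetric] by (intro sum.cong) auto
  thus ?thesis unfolding gchoose_mult_partial_sum by (simp add: algebra_simps)
qed

text \<open>Up to sign the numerators are \<open>x - i\<close> and \<open>x + 1 + i\<close> for
  \<open>i < k\<close>. Pairing \<open>x - i\<close> with \<open>x + i\<close> for
  \<open>0 < i < k\<close> leaves \<open>x\<close> and \<open>x + k\<close>. At
  \<open>x = p * t\<close> this exhibits one factor \<open>p\<close> and a product that is 1 modulo
  \<open>p ^ 2\<close>.\<close>

lemma gchoose_mult_factorization:
  fixes x :: "'a :: field_char_0"
  assumes "k > 0"
  shows "(x gchoose k) * ((- 1 - x) gchoose k)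
    = - (x / of_nat k) * (1 + x / of_nat k) * (\<Prod>i=1..<k. 1 - x\<^sup>2 / (of_nat i)\<^sup>2)"
  using assms
proof (induction k rule: nat_induct_non_zero)
  case 1
  show ?case by (simp add: algebra_simps)
next
  case (Suc k)
  have step: "(x gchoose Suc k) = (x - of_nat k) / of_nat (Suc k) * (x gchoose k)" for x :: 'a
    using gbinomial_mult_1[of x k]
    by (simp add: nonzero_eq_divide_eq algebra_simps del: of_nat_Suc)
  define Q where "Q = (\<Prod>i=1..<k. 1 - x\<^sup>2 / (of_nat i)\<^sup>2)"
  have nz: "of_nat (Suc k) \<noteq> (0 :: 'a)" "of_nat k \<noteq> (0 :: 'a)"
    using Suc.hyps by (simp_all del: of_nat_Suc)
  have "(x gchoose Suc k) * ((- 1 - x) gchoose Suc k)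
      = (x - of_nat k) / of_nat (Suc k) * ((- 1 - x - of_nat k) / of_nat (Suc k))
        * ((x gchoose k) * ((- 1 - x) gchoose k))"
    by (simp only: step ac_simps)
  also have "\<dots> = (x - of_nat k) / of_nat (Suc k) * ((- 1 - x - of_nat k) / of_nat (Suc k))
        * (- (x / of_nat k) * (1 + x / of_nat k) * Q)"
    by (simp only: Suc Q_def)
  also have "\<dots> = - (x / of_nat (Suc k)) * (1 + x / of_nat (Suc k))
        * (Q * (1 - x\<^sup>2 / (of_nat k)\<^sup>2))"
  proof -
    have "(x - K) / L * ((- 1 - x - K) / L) * (- (x / K) * (1 + x / K) * Q)
      = - (x / L) * (1 + x / L) * (Q * (1 - x\<^sup>2 / K\<^sup>2))"
      if "K \<noteq> 0" "L \<noteq> 0" "L = 1 + K" for K L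
      using that(1,2) unfolding that(3) by (simp add: field_simps power2_eq_square)
    thus ?thesis using nz by simp
  qed
  also have "Q * (1 - x\<^sup>2 / (of_nat k)\<^sup>2) = (\<Prod>i=1..<Suc k. 1 - x\<^sup>2 / (of_nat i)\<^sup>2)"
    using Suc by (simp add: Q_def)
  finally show ?case .
qed

context padic_integers
begin

text \<open>The falling factorial of \<open>r\<close> of length \<open>k > r\<close> contains the
  factor 0, and \<open>fact k\<close> is invertible for \<open>k < p\<close>.\<close>

lemma pcong_gchoose_0:
  assumes "x \<in> Zp p" "pcong p 1 x (of_nat r)" "r < k" "k < p"
  shows "pcong p 1 (x gchoose k) 0"
proof -
  have "pcong p 1 (\<Prod>i=0..<k. x - of_nat i) (\<Prod>i=0..<k. of_nat r - of_nat i)"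
    using assms p by (intro pcong_prod pcong_diff) auto
  also have "(\<Prod>i=0..<k. of_nat r - of_nat i) = (0 :: rat)"
    using assms by (intro prod_zero) auto
  finally have "pcong p 1 (fact k * (x gchoose k)) (fact k * 0)"
    by (simp add: gbinomial_mult_fact)
  thus ?thesis by (rule pcong_cancel[OF _ zp_unit_fact[OF \<open>k < p\<close>]])
qed

text \<open>To first order a product changes by the sum of the relative increments
  \<open>d i / c i\<close>; the remaining terms carry \<open>p ^ 2\<close>. The harmonic numbers of
  the second case arise from these sums.\<close>

lemma pcong_prod_first_order:
  assumes "finite I" "\<And>i. i \<in> I \<Longrightarrow> zp_unit p (c i)" "\<And>i. i \<in> I \<Longrightarrow> d i \<in> Zp p"
  shows "pcong p 2 (\<Prod>i\<in>I. c i + of_nat p * d i)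
           ((\<Prod>i\<in>I. c i) * (1 + of_nat p * (\<Sum>i\<in>I. d i / c i)))"
  using assms
proof (induction I)
  case empty
  show ?case using p by simp
next
  case (insert j I)
  define P S where "P = prod c I" and "S = (\<Sum>i\<in>I. d i / c i)"
  have cj: "zp_unit p (c j)" and dj: "d j \<in> Zp p" using insert by auto
  have P: "P \<in> Zp p" unfolding P_def
    using insert p by (intro Zp_prod) (auto intro: zp_unit_Zp)
  have S: "S \<in> Zp p" unfolding S_def
    using insert p by (intro Zp_sum Zp_divide) auto
  have IH: "pcong p 2 (\<Prod>i\<in>I. c i + of_nat p * d i) (P * (1 + of_nat p * S))"
    unfolding P_def S_def using insert by auto
  have "pcong p 2 ((c j + of_nat p * d j) * (\<Prod>i\<in>I. c i + of_nat p * d i))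
          ((c j + of_nat p * d j) * (P * (1 + of_nat p * S)))"
    by (rule pcong_scale[OF IH]) (use cj dj p in \<open>auto intro: zp_unit_Zp\<close>)
  also have "pcong p 2 \<dots> ((c j * P) * (1 + of_nat p * (d j / c j + S)))"
  proof -
    have "(c j + of_nat p * d j) * (P * (1 + of_nat p * S))
        - (c j * P) * (1 + of_nat p * (d j / c j + S)) = of_nat p ^ 2 * (d j * P * S)"
      using zp_unit_nonzero[OF cj] by (simp add: field_simps power2_eq_square)
    moreover have "d j * P * S \<in> Zp p" using dj P S p by auto
    ultimately show ?thesis by (rule pcongI)
  qed
  finally show ?case using insert by (simp add: P_def S_def)
qed

end

section \<open>Evaluation modulo the square of p\<close>

lemma fact_mult_binomial:
  "fact k * of_nat (n choose k) = (\<Prod>i=1..k. of_nat n + 1 - of_nat i :: 'a :: field_char_0)"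
  by (simp add: binomial_gbinomial gbinomial_mult_fact prod.atLeast1_atMost_eq atLeast0LessThan)

lemma fact_mult_prod_add:
  "fact m * (\<Prod>i=1..n. of_nat m + of_nat i) = (fact (m + n) :: 'a :: field_char_0)"
proof (induction n)
  case (Suc n)
  have "fact m * (\<Prod>i=1..Suc n. of_nat m + of_nat i)
      = (fact m * (\<Prod>i=1..n. of_nat m + of_nat i)) * (of_nat (m + Suc n) :: 'a)"
    by (simp add: algebra_simps)
  thus ?case by (simp only: Suc) (simp add: algebra_simps)
qed simp

lemma prod_diff_below:
  "(\<Prod>i=1..n. of_nat i - of_nat (Suc n)) = ((- 1) ^ n * fact n :: 'a :: field_char_0)"
proof -
  have "(\<Prod>i=1..n. of_nat i - of_nat (Suc n) :: 'a)
      = (\<Prod>i=1..n. of_nat (n + 1 - i) - of_nat (Suc n))"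
    by (subst prod.atLeastAtMost_rev) simp
  also have "\<dots> = (\<Prod>i=1..n. - of_nat i)"
    by (intro prod.cong) (auto simp: of_nat_diff)
  finally show ?thesis by (simp add: prod_uminus fact_prod)
qed

lemma harmonic_diff:
  assumes "m \<le> n"
  shows "(\<Sum>i=m+1..n. 1 / of_nat i) = harmonic n - harmonic m"
proof -
  have "{1..n} = {1..m} \<union> {m+1..n}" using assms by auto
  thus ?thesis unfolding harmonic_def by (simp add: sum.union_disjoint)
qed

text \<open>The sum lies strictly between 0 and \<open>2 * p\<close>. This singles out
  \<open>k = p - B\<close> as the only index below \<open>p\<close> with \<open>k + B\<close>
  divisible by \<open>p\<close>.\<close>

lemma dvd_add_less_imp_eq:
  fixes k n p :: nat
  assumes "p dvd k + n" "k < p" "0 < n" "n < p"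
  shows "k + n = p"
proof -
  obtain m where m: "k + n = p * m" using assms(1) by blast
  have "p * m < p * 2" "0 < p * m" using assms(2-4) unfolding m[symmetric] by simp_all
  hence "m = 1" by simp
  thus ?thesis using m by simp
qed

context padic_integers
begin

lemma p_gt_0: "p > 0" and p_gt_1: "p > 1"
  using p prime_gt_0_nat prime_gt_1_nat by auto

text \<open>Replacing \<open>k\<close> by \<open>p - k\<close> makes the sum congruent to its own
  negative, and 2 is invertible because \<open>p\<close> is odd.\<close>

lemma sum_inverse_pcong_0:
  assumes "odd p"
  shows "pcong p 1 (\<Sum>k=1..p-1. 1 / of_nat k) 0"
proof -
  let ?H = "\<Sum>k=1..p-1. 1 / of_nat k :: rat"
  have "?H = (\<Sum>k=1..p-1. 1 / of_nat (p - k))"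
    by (subst sum.atLeastAtMost_rev) (use p_gt_0 in simp)
  also have "pcong p 1 \<dots> (\<Sum>k=1..p-1. 1 / - of_nat k)"
  proof (intro pcong_sum pcong_inverse)
    fix k assume "k \<in> {1..p-1}"
    hence k: "0 < k" "k < p" by auto
    show "pcong p 1 (of_nat (p - k)) (- of_nat k)"
      using k by (auto simp: pcong_def of_nat_diff intro!: bexI[of _ 1])
    show "zp_unit p (of_nat (p - k))" "zp_unit p (- of_nat k)"
      using k by (intro zp_unit_uminus zp_unit_nat_less; simp)+
  qed
  finally have "pcong p 1 (?H + ?H) ((\<Sum>k=1..p-1. 1 / - of_nat k) + ?H)"
    by (intro pcong_add pcong_refl)
  hence "pcong p 1 (of_nat 2 * ?H) (of_nat 2 * 0)"
    by (simp add: sum_negf)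
  moreover have "p \<noteq> 2" using assms by auto
  hence "zp_unit p (of_nat 2)" using p_gt_1 by (intro zp_unit_nat_less) linarith+
  ultimately show ?thesis by (rule pcong_cancel)
qed

end

section \<open>The standing hypotheses and the denominators \<open>k + b\<close>\<close>

locale residue_data = padic_integers +
  fixes A B :: nat and a b s t :: rat
  assumes odd_p: "odd p"
    and s: "s \<in> Zp p" and t: "t \<in> Zp p"
    and a_eq: "a = of_nat A + of_nat p * t" and b_eq: "b = of_nat B + of_nat p * s"
    and B_pos: "0 < B" and AB: "A + B < p"
    and s1: "zp_unit p (1 + s)"
begin

lemma b_cong: "pcong p 1 b (of_nat B)"
  using s by (auto simp: pcong_def b_eq)

lemma b_unit: "zp_unit p b"
  by (rule pcong_1_unit[OF b_cong zp_unit_nat_less]) (use B_pos AB in auto)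

lemma b_Zp: "b \<in> Zp p" and b_nz: "b \<noteq> 0" and s1_nz: "1 + s \<noteq> 0"
  using b_unit s1 zp_unit_Zp zp_unit_nonzero by auto

lemma kb_cong: "pcong p 1 (of_nat k + b) (of_nat (k + B))"
  using pcong_add[OF pcong_refl b_cong, of "of_nat k"] by simp

lemma kb_unit:
  assumes "k < p" "k \<noteq> p - B"
  shows "zp_unit p (of_nat k + b)"
proof (rule pcong_1_unit[OF kb_cong zp_unit_nat])
  show "\<not> p dvd k + B"
    using dvd_add_less_imp_eq[of p k B] assms AB B_pos by auto
qed

text \<open>This is the one denominator that is not a unit. Since \<open>1 + s\<close> is a unit, it
  is divisible by \<open>p\<close> exactly once.\<close>

lemma kb_exceptional: "of_nat (p - B) + b = of_nat p * (1 + s)"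
  using AB by (simp add: b_eq of_nat_diff algebra_simps)

lemma kb_nz: "k < p \<Longrightarrow> of_nat k + b \<noteq> 0"
  using kb_unit[of k] kb_exceptional s1_nz p_gt_0 zp_unit_nonzero
  by (cases "k = p - B") auto

section \<open>Descent from \<open>a\<close> to \<open>p * t\<close>\<close>

definition F :: "rat \<Rightarrow> rat" where
  "F x = (\<Sum>k=0..p-1. (x gchoose k) * ((- 1 - x) gchoose k) * (1 / (of_nat k + b)))"

text \<open>In the recurrence with \<open>n = p - 1\<close> the correction contains two binomials
  whose upper arguments have residues \<open>r - 1\<close> and \<open>p - 1 - r\<close>. Both
  residues are below \<open>p - 1\<close>, so each binomial contributes a factor \<open>p\<close>.
  The divisor \<open>x + b\<close> is a unit because \<open>0 < r + B < p\<close>.\<close>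

lemma F_step:
  assumes "0 < r" "r \<le> A"
  defines "x \<equiv> of_nat r + of_nat p * t"
  shows "pcong p 2 (F x) ((x - b) / (x + b) * F (x - 1))"
proof -
  have x: "x \<in> Zp p" using t by (auto simp: x_def)
  have "pcong p 1 (x - 1) (of_nat (r - 1))"
    using t assms by (auto simp: pcong_def x_def of_nat_diff)
  hence 1: "pcong p 1 ((x - 1) gchoose (p - 1)) 0"
    using x assms AB B_pos by (intro pcong_gchoose_0[of _ "r - 1"]) auto
  have "pcong p 1 (- 1 - x) (of_nat (p - 1 - r))"
  proof -
    have "- 1 - x - of_nat (p - 1 - r) = of_nat p ^ 1 * (- 1 - t)"
      using assms AB by (simp add: x_def of_nat_diff algebra_simps)
    thus ?thesis by (rule pcongI) (use t in auto)
  qed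
  hence 2: "pcong p 1 ((- 1 - x) gchoose (p - 1)) 0"
    using x assms AB B_pos by (intro pcong_gchoose_0[of _ "p - 1 - r"]) auto
  obtain y z where yz: "y \<in> Zp p" "z \<in> Zp p" "(x - 1) gchoose (p - 1) = of_nat p * y"
    "(- 1 - x) gchoose (p - 1) = of_nat p * z"
    using 1 2 by (auto simp: pcong_def)
  have "pcong p 1 (x + b) (of_nat r + of_nat B)"
    using t b_cong by (intro pcong_add) (auto simp: pcong_def x_def)
  hence xb: "zp_unit p (x + b)"
    by (rule pcong_1_unit) (use zp_unit_nat_less[of "r + B"] assms AB in auto)
  have rec: "(x + b) * F x = (x - b) * F (x - 1) + 2 * (of_nat p * y) * (of_nat p * z)"
    unfolding F_def yz(3,4)[symmetric]
    by (rule gchoose_mult_sum_recurrence) (rule kb_nz, use p_gt_0 in auto)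
  have "F x - (x - b) / (x + b) * F (x - 1) = of_nat p ^ 2 * ((2 * y * z) / (x + b))"
    using rec zp_unit_nonzero[OF xb] by (simp add: field_simps power2_eq_square)
  moreover have "(2 * y * z) / (x + b) \<in> Zp p" using yz xb by auto
  ultimately show ?thesis by (rule pcongI)
qed

lemma F_iterate:
  assumes "m \<le> A"
  shows "pcong p 2 (F (of_nat m + of_nat p * t))
    ((\<Prod>i=1..m. (of_nat i + of_nat p * t - b) / (of_nat i + of_nat p * t + b)) * F (of_nat p * t))"
  using assms
proof (induction m)
  case (Suc m)
  let ?x = "of_nat (Suc m) + of_nat p * t"
  have "pcong p 1 (?x + b) (of_nat (Suc m) + of_nat B)"
    using t b_cong by (intro pcong_add) (auto simp: pcong_def)
  hence xb: "zp_unit p (?x + b)"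
    by (rule pcong_1_unit) (use zp_unit_nat_less[of "Suc m + B"] Suc AB in \<open>simp add: add_ac\<close>)
  have c: "(?x - b) / (?x + b) \<in> Zp p" using t b_Zp xb by auto
  have "pcong p 2 (F ?x) ((?x - b) / (?x + b) * F (of_nat m + of_nat p * t))"
    using F_step[of "Suc m"] Suc by simp
  also have "pcong p 2 \<dots> ((?x - b) / (?x + b) *
      ((\<Prod>i=1..m. (of_nat i + of_nat p * t - b) / (of_nat i + of_nat p * t + b)) * F (of_nat p * t)))"
    using Suc by (intro pcong_scale c) simp
  finally show ?case by (simp add: mult_ac)
qed simp

section \<open>The value at \<open>p * t\<close>\<close>

text \<open>The map sending \<open>k\<close> to \<open>(k + B) mod p\<close> permutes the residues
  and takes the omitted index \<open>p - B\<close> to 0, so the sum becomes the one over all nonzero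
  residues.\<close>

lemma sum_shifted_inverse:
  "pcong p 1 (\<Sum>k\<in>{0..<p}-{p-B}. 1 / (of_nat k + b)) 0"
proof -
  have B: "0 < B" "B < p" using B_pos AB by auto
  have nd: "(k + B) mod p \<noteq> 0" if "k < p" "k \<noteq> p - B" for k
    using dvd_add_less_imp_eq[of p k B] that B by (auto simp flip: dvd_eq_mod_eq_0)
  have "pcong p 1 (\<Sum>k\<in>{0..<p}-{p-B}. 1 / (of_nat k + b))
          (\<Sum>k\<in>{0..<p}-{p-B}. 1 / of_nat ((k + B) mod p))"
  proof (intro pcong_sum pcong_inverse)
    fix k assume "k \<in> {0..<p}-{p-B}"
    hence k: "k < p" "k \<noteq> p - B" by auto
    have "of_nat (k + B) - of_nat ((k + B) mod p) = (of_nat p ^ 1 * of_nat ((k + B) div p) :: rat)"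
      by (simp flip: of_nat_mult of_nat_diff add: minus_mod_eq_mult_div del: of_nat_add)
    hence "pcong p 1 (of_nat (k + B)) (of_nat ((k + B) mod p))"
      by (rule pcongI) (rule Zp_nat)
    thus "pcong p 1 (of_nat k + b) (of_nat ((k + B) mod p))" using kb_cong pcong_trans by blast
    show "zp_unit p (of_nat k + b)" using kb_unit k .
    show "zp_unit p (of_nat ((k + B) mod p))"
      using nd[OF k] p_gt_0 by (intro zp_unit_nat_less) auto
  qed
  also have "(\<Sum>k\<in>{0..<p}-{p-B}. 1 / of_nat ((k + B) mod p)) = (\<Sum>j=1..p-1. 1 / of_nat j :: rat)"
  proof (rule sum.reindex_bij_witness[where j = "\<lambda>k. (k + B) mod p" and i = "\<lambda>j. (j + (p - B)) mod p"])
    fix k assume k: "k \<in> {0..<p}-{p-B}"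
    show "((k + B) mod p + (p - B)) mod p = k" using k B by (subst mod_add_left_eq) simp
    have "(k + B) mod p < p" using p_gt_0 by simp
    hence "(k + B) mod p \<le> p - 1" by linarith
    moreover have "1 \<le> (k + B) mod p" using nd[of k] k by (simp add: Suc_le_eq)
    ultimately show "(k + B) mod p \<in> {1..p-1}" by simp
  next
    fix j assume j: "j \<in> {1..p-1}"
    have "j \<le> p - 1" using j by simp
    hence "j < p" using p_gt_0 by linarith
    thus jj: "((j + (p - B)) mod p + B) mod p = j" using B by (subst mod_add_left_eq) simp
    have "(j + (p - B)) mod p \<noteq> p - B"
    proof
      assume "(j + (p - B)) mod p = p - B"
      thus False using jj j B by simp
    qed
    thus "(j + (p - B)) mod p \<in> {0..<p}-{p-B}" using p_gt_0 by auto
  qed auto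
  also have "pcong p 1 \<dots> 0" by (rule sum_inverse_pcong_0[OF odd_p])
  finally show ?thesis .
qed

text \<open>In partial fractions the two complete sums vanish modulo \<open>p\<close>, so only the
  omitted terms count. The first sum lacks \<open>1 / (p - B)\<close>, congruent to
  \<open>- 1 / b\<close>, and the second lacks \<open>1 / b\<close> at \<open>k = 0\<close>; each
  contributes \<open>1 / b\<close> inside the bracket.\<close>

lemma sum_product_inverse:
  "pcong p 1 (\<Sum>k\<in>{1..p-1}-{p-B}. 1 / (of_nat k * (of_nat k + b))) (2 / b\<^sup>2)"
proof -
  let ?K = "{1..p-1}-{p-B}"
  have B: "0 < B" "B < p" using B_pos AB by auto
  have "(\<Sum>k=1..p-1. 1 / of_nat k :: rat) = 1 / of_nat (p - B) + (\<Sum>k\<in>?K. 1 / of_nat k)"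
    using B by (intro sum.remove) auto
  hence e1: "(\<Sum>k\<in>?K. 1 / of_nat k :: rat) = (\<Sum>k=1..p-1. 1 / of_nat k) - 1 / of_nat (p - B)"
    by simp
  have "pcong p 1 (1 / of_nat (p - B)) (1 / - b)"
  proof (rule pcong_inverse)
    have "of_nat (p - B) - - b = of_nat p ^ 1 * (1 + s)" using kb_exceptional by simp
    thus "pcong p 1 (of_nat (p - B)) (- b)" by (rule pcongI) (use s in auto)
    show "zp_unit p (of_nat (p - B))" using B by (intro zp_unit_nat_less) auto
    show "zp_unit p (- b)" using b_unit by (rule zp_unit_uminus)
  qed
  hence 1: "pcong p 1 (\<Sum>k\<in>?K. 1 / of_nat k) (0 - 1 / - b)"
    unfolding e1 by (intro pcong_diff sum_inverse_pcong_0 odd_p)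
  have "{0..<p}-{p-B} = insert 0 ?K" using B by auto
  hence "(\<Sum>k\<in>?K. 1 / (of_nat k + b)) = (\<Sum>k\<in>{0..<p}-{p-B}. 1 / (of_nat k + b)) - 1 / b"
    by simp
  hence 2: "pcong p 1 (\<Sum>k\<in>?K. 1 / (of_nat k + b)) (0 - 1 / b)"
    using pcong_diff[OF sum_shifted_inverse pcong_refl] by simp
  have "(\<Sum>k\<in>?K. 1 / (of_nat k * (of_nat k + b)))
      = (\<Sum>k\<in>?K. 1 / b * (1 / of_nat k - 1 / (of_nat k + b)))"
  proof (rule sum.cong)
    fix k assume "k \<in> ?K"
    hence "k < p" "k \<noteq> 0" by auto
    hence "of_nat k + b \<noteq> 0" "of_nat k \<noteq> (0 :: rat)" using kb_nz by auto
    thus "1 / (of_nat k * (of_nat k + b)) = 1 / b * (1 / of_nat k - 1 / (of_nat k + b))"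
      using b_nz by (simp add: field_simps)
  qed simp
  also have "\<dots> = 1 / b * ((\<Sum>k\<in>?K. 1 / of_nat k) - (\<Sum>k\<in>?K. 1 / (of_nat k + b)))"
    by (simp only: sum_subtractf flip: sum_distrib_left)
  also have "pcong p 1 \<dots> (1 / b * ((0 - 1 / - b) - (0 - 1 / b)))"
    using b_unit by (intro pcong_scale pcong_diff 1 2) auto
  also have "1 / b * ((0 - 1 / - b) - (0 - 1 / b)) = 2 / b\<^sup>2"
    by (simp add: power2_eq_square)
  finally show ?thesis .
qed

text \<open>Every term with \<open>k > 0\<close> has a factor \<open>x = p * t\<close>. For
  \<open>k = p - B\<close> the denominator \<open>p * (1 + s)\<close> consumes it, so this term must
  be expanded to full precision; the others matter only modulo \<open>p\<close>.\<close>

lemma F_base: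
  "pcong p 2 (F (of_nat p * t)) ((1 + s + t) / (b * (1 + s)) * (1 - of_nat p * t / b))"
proof -
  define x where "x = of_nat p * t"
  define Q where "Q k = (\<Prod>i=1..<k. 1 - x\<^sup>2 / (of_nat i)\<^sup>2)" for k :: nat
  define f where "f k = (x gchoose k) * ((- 1 - x) gchoose k) * (1 / (of_nat k + b))" for k
  let ?K = "{1..p-1}-{p-B}"
  have B: "0 < B" "B < p" using B_pos AB by auto
  have x: "x \<in> Zp p" using t by (auto simp: x_def)
  have Q: "pcong p 2 (Q k) 1" if "k < p" for k
  proof -
    have "pcong p 2 (Q k) (\<Prod>i=1..<k. 1 - 0)"
      unfolding Q_def
    proof (intro pcong_prod pcong_diff pcong_refl)
      fix i assume i: "i \<in> {1..<k}"
      hence "zp_unit p ((of_nat i)\<^sup>2)" unfolding power2_eq_square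
        using that by (intro zp_unit_mult zp_unit_nat_less) auto
      hence "t\<^sup>2 / (of_nat i)\<^sup>2 \<in> Zp p" using t by auto
      moreover have "x\<^sup>2 / (of_nat i)\<^sup>2 - 0 = of_nat p ^ 2 * (t\<^sup>2 / (of_nat i)\<^sup>2)"
        by (simp add: x_def power_mult_distrib)
      ultimately show "pcong p 2 (x\<^sup>2 / (of_nat i)\<^sup>2) 0" by (intro pcongI)
    qed auto
    thus ?thesis by simp
  qed
  have f: "f k = - (x / of_nat k) * (1 + x / of_nat k) * Q k * (1 / (of_nat k + b))" if "k > 0" for k
    using gchoose_mult_factorization[OF that, of x] by (simp add: f_def Q_def)
  define c where "c = (of_nat (p - B) :: rat)"
  have c: "zp_unit p c" unfolding c_def using B by (intro zp_unit_nat_less) auto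
  have c_eq: "c = of_nat p * (1 + s) - b" using kb_exceptional by (simp add: c_def)
  have x_cong: "pcong p 1 (1 + x / of_nat k) 1" if "0 < k" "k < p" for k
  proof -
    have "1 + x / of_nat k - 1 = of_nat p ^ 1 * (t / of_nat k)" by (simp add: x_def)
    moreover have "t / of_nat k \<in> Zp p" using t that by (intro Zp_divide zp_unit_nat_less)
    ultimately show ?thesis by (rule pcongI)
  qed
  have exceptional: "pcong p 2 (f (p - B)) (- (t / (1 + s)) * (1 / c * (1 + x / c)))"
  proof -
    have "f (p - B) = - (x / c) * (1 + x / c) * Q (p - B) * (1 / (of_nat p * (1 + s)))"
      using f[of "p - B"] B unfolding kb_exceptional c_def by simp
    also have "\<dots> = - (t / (1 + s)) * (1 / c * (1 + x / c)) * Q (p - B)"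
      using p_gt_0 by (simp add: x_def mult_ac)
    also have "pcong p 2 \<dots> (- (t / (1 + s)) * (1 / c * (1 + x / c)) * 1)"
      using B t x c s1 by (intro pcong_scale Q) (auto intro!: Zp_mult Zp_add Zp_uminus Zp_divide zp_unit_mult)
    finally show ?thesis by simp
  qed
  have ordinary: "pcong p 2 (f k) (of_nat p * (- t * (1 / (of_nat k * (of_nat k + b)))))"
    if "k \<in> ?K" for k
  proof -
    have k: "0 < k" "k < p" "k \<noteq> p - B" using that by auto
    have u: "zp_unit p (of_nat k * (of_nat k + b))"
      using k by (intro zp_unit_mult kb_unit zp_unit_nat_less)
    have "pcong p 1 ((1 + x / of_nat k) * Q k) (1 * 1)"
      using x_cong[OF k(1,2)] pcong_Suc_imp[of 1 "Q k" 1] Q[OF k(2)] pcong_Zp[OF Q[OF k(2)]]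
      by (intro pcong_mult) (simp_all add: numeral_2_eq_2)
    hence "pcong p 1 (- t * (1 / (of_nat k * (of_nat k + b))) * ((1 + x / of_nat k) * Q k))
             (- t * (1 / (of_nat k * (of_nat k + b))) * (1 * 1))"
      using t u by (intro pcong_scale) auto
    from pcong_p_mult[OF this] show ?thesis using k by (simp add: f x_def numeral_2_eq_2 mult_ac)
  qed
  have "F x = sum f {0..p-1}" by (simp add: F_def f_def)
  also have "{0..p-1} = insert 0 (insert (p - B) ?K)" using B by auto
  also have "sum f \<dots> = f 0 + (f (p - B) + sum f ?K)"
    using B by (subst sum.insert, simp, simp, subst sum.insert) simp_all
  finally have "F x = f 0 + (f (p - B) + sum f ?K)" .
  also have "f 0 = 1 / b" by (simp add: f_def)
  also have "pcong p 2 (1 / b + (f (p - B) + sum f ?K))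
      (1 / b + (- (t / (1 + s)) * (1 / c * (1 + x / c))
        + (\<Sum>k\<in>?K. of_nat p * (- t * (1 / (of_nat k * (of_nat k + b)))))))"
    by (intro pcong_add pcong_sum exceptional ordinary pcong_refl)
  also have "(\<Sum>k\<in>?K. of_nat p * (- t * (1 / (of_nat k * (of_nat k + b)))))
      = of_nat p * (- t * (\<Sum>k\<in>?K. 1 / (of_nat k * (of_nat k + b))))"
    by (simp only: sum_distrib_left)
  also have "pcong p 2 (1 / b + (- (t / (1 + s)) * (1 / c * (1 + x / c))
        + of_nat p * (- t * (\<Sum>k\<in>?K. 1 / (of_nat k * (of_nat k + b))))))
      (1 / b + (- (t / (1 + s)) * (- 1 / b * (1 + of_nat p * (1 + s - t) / b))
        + of_nat p * (- t * (2 / b\<^sup>2))))"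
  proof (rule pcong_add[OF pcong_refl pcong_add[OF pcong_scale]])
    show "- (t / (1 + s)) \<in> Zp p" using t s1 by auto
    show "pcong p 2 (of_nat p * (- t * (\<Sum>k\<in>?K. 1 / (of_nat k * (of_nat k + b)))))
            (of_nat p * (- t * (2 / b\<^sup>2)))"
      using pcong_p_mult[OF pcong_scale[OF sum_product_inverse, of "- t"]] t
      by (simp add: numeral_2_eq_2)
    \<comment> \<open>These are the first two terms of the geometric series for
      \<open>1 / c\<close>, with \<open>c\<close> written as
      \<open>- b * (1 - p * (1 + s) / b)\<close>.\<close>
    have e1: "1 / c - (- 1 / b * (1 + of_nat p * (1 + s) / b)) = of_nat p ^ 2 * ((1 + s)\<^sup>2 / (b * b * c))"
    proof -
      have "1 / c - (- 1 / b * (1 + of_nat p * (1 + s) / b))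
          = (b * b + c * (b + of_nat p * (1 + s))) / (b * b * c)"
        using b_nz zp_unit_nonzero[OF c] by (simp add: field_simps)
      also have "b * b + c * (b + of_nat p * (1 + s)) = of_nat p ^ 2 * (1 + s)\<^sup>2"
        unfolding c_eq by (simp add: algebra_simps power2_eq_square)
      finally show ?thesis by simp
    qed
    have "(1 + s)\<^sup>2 / (b * b * c) \<in> Zp p"
      by (intro Zp_divide zp_unit_mult Zp_mult Zp_power Zp_add Zp_1 b_unit c s t)
    hence c2: "pcong p 2 (1 / c) (- 1 / b * (1 + of_nat p * (1 + s) / b))"
      by (rule pcongI[OF e1])
    \<comment> \<open>Since \<open>x\<close> already has a factor \<open>p\<close> and
      \<open>b + c = p * (1 + s)\<close>, replacing \<open>c\<close> by \<open>- b\<close> costs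
      only a multiple of \<open>p ^ 2\<close>.\<close>
    have e2: "(1 + x / c) - (1 - x / b) = of_nat p ^ 2 * (t * (1 + s) / (b * c))"
    proof -
      have "(1 + x / c) - (1 - x / b) = x * (b + c) / (b * c)"
        using b_nz zp_unit_nonzero[OF c] by (simp add: field_simps)
      thus ?thesis by (simp add: c_eq x_def power2_eq_square)
    qed
    have "t * (1 + s) / (b * c) \<in> Zp p"
      by (intro Zp_divide zp_unit_mult Zp_mult Zp_power Zp_add Zp_1 b_unit c s t)
    hence x2: "pcong p 2 (1 + x / c) (1 - x / b)"
      by (rule pcongI[OF e2])
    have "pcong p 2 (1 / c * (1 + x / c))
        ((- 1 / b * (1 + of_nat p * (1 + s) / b)) * (1 - x / b))"
      using x c s b_unit by (intro pcong_mult c2 x2) (auto intro!: Zp_mult Zp_add Zp_divide)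
    also have "pcong p 2 \<dots> (- 1 / b * (1 + of_nat p * (1 + s - t) / b))"
    proof -
      have "(- 1 / b * (1 + of_nat p * (1 + s) / b)) * (1 - x / b)
          - - 1 / b * (1 + of_nat p * (1 + s - t) / b) = of_nat p ^ 2 * ((1 + s) * t / (b * b * b))"
        using b_nz by (simp add: x_def field_simps power2_eq_square)
      moreover have "(1 + s) * t / (b * b * b) \<in> Zp p"
        by (intro Zp_divide zp_unit_mult Zp_mult Zp_power Zp_add Zp_1 b_unit c s t)
      ultimately show ?thesis by (rule pcongI)
    qed
    finally show "pcong p 2 (1 / c * (1 + x / c)) (- 1 / b * (1 + of_nat p * (1 + s - t) / b))" .
  qed
  also have "1 / b + (- (t / (1 + s)) * (- 1 / b * (1 + of_nat p * (1 + s - t) / b))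
        + of_nat p * (- t * (2 / b\<^sup>2)))
      = (1 + s + t) / (b * (1 + s)) * (1 - of_nat p * t / b)"
  proof -
    \<comment> \<open>With \<open>u\<close> standing for \<open>1 + s\<close>, the coefficient of
      \<open>p\<close> has numerator \<open>t * (u - t) - 2 * t * u = - t * (u + t)\<close>, which
      is why \<open>u + t\<close> factors out.\<close>
    have "1 / b + (- (t / u) * (- 1 / b * (1 + of_nat p * (u - t) / b))
        + of_nat p * (- t * (2 / b\<^sup>2))) = (u + t) / (b * u) * (1 - of_nat p * t / b)"
      if "u \<noteq> 0" for u
      using that b_nz by (simp add: field_simps power2_eq_square)
    from this[OF s1_nz] show ?thesis .
  qed
  finally show ?thesis by (simp add: x_def)
qed

section \<open>The value at \<open>a\<close> as a quotient of products\<close>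

lemma shift_cong: "pcong p 1 (of_nat i + of_nat p * t + b) (of_nat i + of_nat B)"
  by (intro pcong_add b_cong) (use t in \<open>auto intro: pcongI\<close>)

lemma shift_unit:
  assumes "i \<le> A"
  shows "zp_unit p (of_nat i + of_nat p * t + b)"
proof (rule pcong_1_unit[OF shift_cong])
  show "zp_unit p (of_nat i + of_nat B)"
    using zp_unit_nat_less[of "i + B"] assms AB B_pos by simp
qed

lemma F_a:
  "pcong p 2 (F a)
    ((\<Prod>i=1..A. of_nat i + of_nat p * t - b) / (\<Prod>i=1..A. of_nat i + of_nat p * t + b)
     * ((1 + s + t) / (b * (1 + s)) * (1 - of_nat p * t / b)))"
proof -
  let ?P = "\<Prod>i=1..A. (of_nat i + of_nat p * t - b) / (of_nat i + of_nat p * t + b)"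
  have "?P \<in> Zp p"
    using t b_Zp shift_unit by (intro Zp_prod Zp_divide) auto
  hence "pcong p 2 (?P * F (of_nat p * t))
      (?P * ((1 + s + t) / (b * (1 + s)) * (1 - of_nat p * t / b)))"
    by (intro pcong_scale F_base)
  with F_iterate[of A] show ?thesis
    unfolding a_eq prod_dividef by (blast intro: pcong_trans)
qed

lemma prefactor_Zp: "(1 + s + t) / (b * (1 + s)) \<in> Zp p"
  using s t b_unit s1 by (intro Zp_divide zp_unit_mult) auto

section \<open>The case \<open>B \<le> A\<close>\<close>

text \<open>Modulo \<open>p\<close>, \<open>b\<close> becomes \<open>B\<close> and
  \<open>p * t\<close> disappears, which turns both products into factorials up to sign. The second
  binomial is congruent to \<open>(- 1) ^ B\<close> times \<open>(A + B) choose B\<close>, and the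
  leading minus sign settles the parity.\<close>

lemma binomial_product_cong:
  assumes "B \<le> A"
  shows "pcong p 1
    (- (\<Prod>i\<in>{1..A}-{B}. of_nat i + of_nat p * t - b) / (\<Prod>i=1..A. of_nat i + of_nat p * t + b))
    (1 / (b * of_nat (A choose B) * of_nat ((p - 1 - A) choose B)))"
proof -
  let ?K = "{1..A}-{B}"
  define N where "N = (\<Prod>i\<in>?K. of_nat i + of_nat p * t - b)"
  define D where "D = (\<Prod>i=1..A. of_nat i + of_nat p * t + b)"
  define n0 :: rat where "n0 = (\<Prod>i\<in>?K. of_nat i - of_nat B)"
  define d0 :: rat where "d0 = (\<Prod>i=1..A. of_nat i + of_nat B)"
  define g :: rat where "g = (\<Prod>i=1..B. of_nat A + of_nat i)"
  define C1 C2 :: rat where "C1 = of_nat (A choose B)" and "C2 = of_nat ((p - 1 - A) choose B)"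
  have AB': "A < p" "B < p" using AB by auto
  obtain B' where B': "B = Suc B'" using B_pos by (cases B) auto
  have N: "pcong p 1 N n0" unfolding N_def n0_def
  proof (intro pcong_prod pcong_diff b_cong)
    show "pcong p 1 (of_nat i + of_nat p * t) (of_nat i)" for i
      using t by (auto intro: pcongI)
  qed auto
  have D: "pcong p 1 D d0" unfolding D_def d0_def
    by (intro pcong_prod shift_cong) auto
  have D_unit: "zp_unit p D" unfolding D_def by (intro zp_unit_prod shift_unit) auto
  have C1: "C1 * (fact B * fact (A - B)) = fact A"
    using arg_cong[OF binomial_fact_lemma[OF assms], of "of_nat :: nat \<Rightarrow> rat"]
    by (simp add: C1_def mult_ac)
  \<comment> \<open>The factors of the falling factorial are \<open>p - (A + i)\<close>, hence
    congruent to \<open>- (A + i)\<close>.\<close>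
  have C2: "pcong p 1 (fact B * C2) ((- 1) ^ B * g)"
  proof -
    have "fact B * C2 = (\<Prod>i=1..B. of_nat (p - 1 - A) + 1 - of_nat i)"
      unfolding C2_def by (rule fact_mult_binomial)
    also have "pcong p 1 \<dots> (\<Prod>i=1..B. - (of_nat A + of_nat i))"
    proof (intro pcong_prod)
      fix i
      have "of_nat (p - 1 - A) + 1 - of_nat i - - (of_nat A + of_nat i) = (of_nat p ^ 1 * 1 :: rat)"
        using AB by (simp add: of_nat_diff)
      thus "pcong p 1 (of_nat (p - 1 - A) + 1 - of_nat i) (- (of_nat A + of_nat i))"
        by (rule pcongI) simp
    qed auto
    finally show ?thesis by (simp only: prod_uminus g_def card_atLeastAtMost diff_Suc_1)
  qed
  have g: "fact A * g = fact (A + B)" and d0: "fact B * d0 = fact (A + B)"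
    using fact_mult_prod_add[of A B] fact_mult_prod_add[of B A]
    by (simp_all add: g_def d0_def add.commute)
  \<comment> \<open>Below the omitted index \<open>B\<close> there are \<open>B' = B - 1\<close>
    negative factors; the factors above it run through \<open>1\<close> to
    \<open>A - B\<close>.\<close>
  have n0: "n0 = (- 1) ^ B' * fact B' * fact (A - B)"
  proof -
    have "?K = {1..B'} \<union> {B'+2..A}" using assms B' by auto
    hence "n0 = (\<Prod>i=1..B'. of_nat i - of_nat (Suc B')) * (\<Prod>i=B'+2..A. of_nat i - of_nat (Suc B'))"
      unfolding n0_def B' by (simp add: prod.union_disjoint)
    also have "(\<Prod>i=B'+2..A. of_nat i - of_nat (Suc B')) = (\<Prod>i=1..A-B. of_nat i :: rat)"
      by (rule prod.reindex_bij_witness[of _ "\<lambda>i. i + B" "\<lambda>i. i - B"])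
         (use assms B' in \<open>auto simp: of_nat_diff\<close>)
    finally show ?thesis by (simp only: prod_diff_below fact_prod of_nat_prod) 
  qed
  have C1_unit: "zp_unit p C1"
  proof -
    have "C1 = fact A / (fact B * fact (A - B))" using C1 by (simp add: field_simps)
    thus ?thesis using AB' by (auto intro!: zp_unit_divide zp_unit_mult zp_unit_fact)
  qed
  have g_unit: "zp_unit p g"
  proof -
    have "g = fact (A + B) / fact A" using g by (simp add: field_simps)
    thus ?thesis using AB by (auto intro!: zp_unit_divide zp_unit_fact)
  qed
  have "zp_unit p ((- 1) ^ B * g)"
    using g_unit by (cases "even B") (auto intro: zp_unit_uminus)
  hence "zp_unit p (fact B * C2)" by (rule pcong_1_unit[OF C2])
  hence "zp_unit p (fact B * C2 / fact B)" using AB' by (intro zp_unit_divide zp_unit_fact)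
  hence C2_unit: "zp_unit p C2" by simp
  have e: "- n0 * (fact B * of_nat B * C1 * ((- 1) ^ B * g)) = fact B * fact B * d0"
  proof -
    have "- n0 * (fact B * of_nat B * C1 * ((- 1) ^ B * g))
        = (of_nat B * fact B') * (C1 * (fact B * fact (A - B))) * g * ((- 1) ^ B' * (- 1) ^ B')"
      by (simp add: n0 B' algebra_simps)
    also have "\<dots> = fact B * (fact A * g)"
      unfolding C1 by (simp add: B' flip: power_mult_distrib)
    also have "\<dots> = fact B * fact B * d0" by (simp only: g d0 mult.assoc)
    finally show ?thesis .
  qed
  have fact_Zp: "(fact B :: rat) \<in> Zp p" using zp_unit_Zp[OF zp_unit_fact[OF AB'(2)]] .
  \<comment> \<open>The comparison is made without denominators. One \<open>fact B\<close> completes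
    \<open>d0\<close> to \<open>fact (A + B)\<close>, the other turns \<open>C2\<close> into a
    falling factorial.\<close>
  have "pcong p 1 (- N * (fact B * b * C1 * (fact B * C2)))
          (- n0 * (fact B * of_nat B * C1 * ((- 1) ^ B * g)))"
  proof -
    have C_Zp: "C1 \<in> Zp p" "C2 \<in> Zp p" by (simp_all add: C1_def C2_def)
    have "pcong p 1 (fact B * C1 * b) (fact B * C1 * of_nat B)"
      by (rule pcong_scale[OF b_cong Zp_mult[OF fact_Zp C_Zp(1)]])
    hence "pcong p 1 (fact B * b * C1) (fact B * of_nat B * C1)" by (simp only: mult_ac)
    from pcong_mult[OF this C2] have "pcong p 1 (fact B * b * C1 * (fact B * C2))
        (fact B * of_nat B * C1 * ((- 1) ^ B * g))"
      by (simp add: fact_Zp C_Zp)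
    moreover have "- n0 \<in> Zp p" unfolding n0_def by (intro Zp_uminus Zp_prod) auto
    ultimately show ?thesis
      by (intro pcong_mult[OF pcong_minus[OF N]] Zp_mult fact_Zp C_Zp b_Zp)
  qed
  also note e
  also have "pcong p 1 (fact B * fact B * d0) (fact B * fact B * D)"
    by (rule pcong_scale[OF pcong_sym[OF D] Zp_mult[OF fact_Zp fact_Zp]])
  finally have "pcong p 1 (fact B * fact B * (- N * (b * C1 * C2))) (fact B * fact B * D)"
    by (simp add: mult_ac)
  hence "pcong p 1 (- N * (b * C1 * C2)) D"
    by (rule pcong_cancel) (intro zp_unit_mult zp_unit_fact AB')
  hence "pcong p 1 (1 / (D * (b * C1 * C2)) * (- N * (b * C1 * C2))) (1 / (D * (b * C1 * C2)) * D)"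
    by (rule pcong_scale) (intro Zp_divide Zp_1 zp_unit_mult D_unit b_unit C1_unit C2_unit)
  moreover have "b * C1 * C2 \<noteq> 0" "D \<noteq> 0"
    using zp_unit_nonzero b_unit C1_unit C2_unit D_unit by auto
  ultimately have "pcong p 1 (- N / D) (1 / (b * C1 * C2))" by (simp add: field_simps)
  thus ?thesis unfolding N_def D_def C1_def C2_def .
qed

text \<open>The factor \<open>i = B\<close> of the numerator equals \<open>p * (t - s)\<close>. With
  this \<open>p\<close> extracted, the rest is needed only modulo \<open>p\<close>, where
  \<open>1 - p * t / b\<close> becomes 1.\<close>

lemma F_a_le:
  assumes "B \<le> A"
  defines "R \<equiv> of_nat p * (s + t + 1) * (s - t) /
               (b ^ 2 * (s + 1) * of_nat (A choose B) * of_nat ((p - 1 - A) choose B))"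
  shows "pcong p 2 (F a) R" "R \<in> Zp p"
proof -
  define N where "N = (\<Prod>i\<in>{1..A}-{B}. of_nat i + of_nat p * t - b)"
  define D where "D = (\<Prod>i=1..A. of_nat i + of_nat p * t + b)"
  define C where "C = (of_nat (A choose B) * of_nat ((p - 1 - A) choose B) :: rat)"
  define M where "M = (1 + s + t) / (b * (1 + s))"
  have "D \<noteq> 0" unfolding D_def by (intro zp_unit_nonzero zp_unit_prod shift_unit) auto
  have ND: "pcong p 1 (- N / D) (1 / (b * C))"
    using binomial_product_cong[OF assms(1)] by (simp add: N_def D_def C_def mult.assoc)
  have ND_Zp: "- N / D \<in> Zp p" unfolding N_def D_def
    using t b_Zp by (intro Zp_divide Zp_uminus Zp_prod zp_unit_prod shift_unit) auto
  have "(\<Prod>i=1..A. of_nat i + of_nat p * t - b) = (of_nat B + of_nat p * t - b) * N"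
    unfolding N_def using assms B_pos by (intro prod.remove) auto
  also have "of_nat B + of_nat p * t - b = of_nat p * (t - s)"
    by (simp add: b_eq algebra_simps)
  finally have "pcong p 2 (F a) (of_nat p * (t - s) * N / D * (M * (1 - of_nat p * t / b)))"
    using F_a by (simp add: D_def M_def)
  also have "of_nat p * (t - s) * N / D * (M * (1 - of_nat p * t / b))
      = of_nat p * (M * (s - t) * ((1 - of_nat p * t / b) * (- N / D)))"
  proof -
    have "P * (t - s) * N / D * (M * Y) = P * (M * (s - t) * (Y * (- N / D)))" for P Y
      using \<open>D \<noteq> 0\<close> by (simp add: field_simps)
    thus ?thesis .
  qed
  also have "pcong p 2 \<dots> (of_nat p * (M * (s - t) * (1 * (1 / (b * C)))))"
  proof -
    have "1 - of_nat p * t / b - 1 = of_nat p ^ 1 * (- (t / b))" by simp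
    hence 1: "pcong p 1 (1 - of_nat p * t / b) 1"
      by (rule pcongI) (use t b_unit in auto)
    have "pcong p 1 (M * (s - t) * ((1 - of_nat p * t / b) * (- N / D)))
        (M * (s - t) * (1 * (1 / (b * C))))"
      using s t prefactor_Zp[folded M_def] by (intro pcong_scale pcong_mult 1 ND ND_Zp) auto
    from pcong_p_mult[OF this] show ?thesis by (simp add: numeral_2_eq_2)
  qed
  also have R: "of_nat p * (M * (s - t) * (1 * (1 / (b * C)))) = R"
    by (simp add: R_def C_def M_def power2_eq_square add_ac mult_ac)
  finally show "pcong p 2 (F a) R" .
  \<comment> \<open>Integrality is inherited through the congruence with
    \<open>- N / D\<close>.\<close>
  have "1 / (b * C) \<in> Zp p" using pcong_Zp[OF pcong_sym[OF ND] ND_Zp] .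
  thus "R \<in> Zp p" unfolding R[symmetric]
    using s t prefactor_Zp[folded M_def] by (intro Zp_mult) auto
qed

section \<open>The case \<open>A < B\<close>\<close>

lemma harmonic_Zp: "n < p \<Longrightarrow> harmonic n \<in> Zp p"
  unfolding harmonic_def by (intro Zp_sum Zp_divide zp_unit_nat_less) auto

lemma sum_inverse_add: "(\<Sum>i=1..A. 1 / (of_nat i + of_nat B)) = harmonic (A + B) - harmonic B"
proof -
  have "(\<Sum>i=1..A. 1 / (of_nat i + of_nat B)) = (\<Sum>i=B+1..A+B. 1 / of_nat i :: rat)"
    by (rule sum.reindex_bij_witness[of _ "\<lambda>i. i - B" "\<lambda>i. i + B"]) auto
  thus ?thesis using harmonic_diff[of B "A + B"] by simp
qed

lemma sum_inverse_diff:
  assumes "A < B"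
  shows "(\<Sum>i=1..A. 1 / (of_nat i - of_nat B)) = harmonic (B - A - 1) - harmonic (B - 1)"
proof -
  have "(\<Sum>i=1..A. 1 / (of_nat i - of_nat B)) = (\<Sum>i=1..A. - (1 / of_nat (B - i)) :: rat)"
    using assms by (intro sum.cong) (auto simp: of_nat_diff field_simps)
  also have "\<dots> = - (\<Sum>i=1..A. 1 / of_nat (B - i))" by (rule sum_negf)
  also have "(\<Sum>i=1..A. 1 / of_nat (B - i)) = (\<Sum>i=(B-A-1)+1..B-1. 1 / of_nat i :: rat)"
    by (rule sum.reindex_bij_witness[of _ "\<lambda>i. B - i" "\<lambda>i. B - i"]) (use assms in auto)
  finally show ?thesis using harmonic_diff[of "B - A - 1" "B - 1"] by simp
qed

text \<open>The binomial quotient in \<open>R\<close> is exactly \<open>n0 / E\<close>, while the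
  value at \<open>a\<close> involves \<open>N / D\<close>. First-order expansions of
  \<open>N\<close>, \<open>D\<close> and \<open>E\<close> around \<open>n0\<close> and
  \<open>d0\<close> reduce the claim to comparing the coefficients of \<open>p\<close>.\<close>

lemma F_a_gt:
  assumes "A < B"
  defines "R \<equiv> (s + 1 + t) / (b * (s + 1)) *
               (of_nat ((B - 1) choose A) / of_nat ((p - 1 - B) choose A)) *
               (1 + of_nat p * ((s + 1) / b)
                  + of_nat p * (2 * s + 1) * harmonic (B - 1)
                  - of_nat p * (s - t) * harmonic (B - A - 1)
                  - of_nat p * (s + t + 1) * harmonic (A + B))"
  shows "pcong p 2 (F a) R" "R \<in> Zp p"
proof -
  define N where "N = (\<Prod>i=1..A. of_nat i + of_nat p * t - b)"
  define D where "D = (\<Prod>i=1..A. of_nat i + of_nat p * t + b)"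
  \<comment> \<open>Up to the sign \<open>(- 1) ^ A\<close> this is \<open>fact A\<close> times
    \<open>(p - 1 - B) choose A\<close>, with \<open>p\<close> retained because precision
    \<open>p ^ 2\<close> is required.\<close>
  define E :: rat where "E = (\<Prod>i=1..A. of_nat i + of_nat B - of_nat p)"
  define n0 :: rat where "n0 = (\<Prod>i=1..A. of_nat i - of_nat B)"
  define d0 :: rat where "d0 = (\<Prod>i=1..A. of_nat i + of_nat B)"
  define h where "h = harmonic (A + B) - harmonic B"
  define e where "e = harmonic (B - A - 1) - harmonic (B - 1)"
  define M where "M = (1 + s + t) / (b * (1 + s))"
  \<comment> \<open>The coefficient \<open>2 * s + 1\<close> is
    \<open>(s - t) + (s + t + 1)\<close>: \<open>harmonic (B - 1)\<close> enters once through
    \<open>e\<close> and once through \<open>h\<close> after \<open>1 / B\<close> is split off from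
    \<open>harmonic B\<close>.\<close>
  define X where "X = (s + 1) / b + (2 * s + 1) * harmonic (B - 1)
      - (s - t) * harmonic (B - A - 1) - (s + t + 1) * harmonic (A + B)"
  have unit_minus: "zp_unit p (of_nat i - of_nat B)" if "i \<in> {1..A}" for i
  proof -
    have "zp_unit p (- of_nat (B - i))"
      using that assms AB by (intro zp_unit_uminus zp_unit_nat_less) auto
    thus ?thesis using that assms by (simp add: of_nat_diff)
  qed
  have unit_plus: "zp_unit p (of_nat i + of_nat B)" if "i \<in> {1..A}" for i
    using zp_unit_nat_less[of "i + B"] that AB by simp
  have hZ: "harmonic (B - 1) \<in> Zp p" "harmonic (B - A - 1) \<in> Zp p" "harmonic (A + B) \<in> Zp p"
    "harmonic B \<in> Zp p"
    using AB by (auto intro!: harmonic_Zp)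
  have XZ: "X \<in> Zp p" unfolding X_def
    by (intro Zp_add Zp_diff Zp_mult Zp_divide hZ s t b_unit Zp_1 Zp_numeral)
  have eZ: "e \<in> Zp p" and hhZ: "h \<in> Zp p" unfolding e_def h_def using hZ by auto
  have N: "pcong p 2 N (n0 * (1 + of_nat p * ((t - s) * e)))"
  proof -
    have "N = (\<Prod>i=1..A. (of_nat i - of_nat B) + of_nat p * (t - s))"
      unfolding N_def by (intro prod.cong) (auto simp: b_eq algebra_simps)
    also have "pcong p 2 \<dots> ((\<Prod>i=1..A. of_nat i - of_nat B)
        * (1 + of_nat p * (\<Sum>i=1..A. (t - s) / (of_nat i - of_nat B))))"
      using s t unit_minus by (intro pcong_prod_first_order) auto
    also have "(\<Sum>i=1..A. (t - s) / (of_nat i - of_nat B)) = (t - s) * e"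
      using sum_inverse_diff[OF assms(1)] by (simp add: e_def divide_inverse flip: sum_distrib_left)
    finally show ?thesis by (simp add: n0_def)
  qed
  have D: "pcong p 2 D (d0 * (1 + of_nat p * ((s + t) * h)))"
  proof -
    have "D = (\<Prod>i=1..A. (of_nat i + of_nat B) + of_nat p * (s + t))"
      unfolding D_def by (intro prod.cong) (auto simp: b_eq algebra_simps)
    also have "pcong p 2 \<dots> ((\<Prod>i=1..A. of_nat i + of_nat B)
        * (1 + of_nat p * (\<Sum>i=1..A. (s + t) / (of_nat i + of_nat B))))"
      using s t unit_plus by (intro pcong_prod_first_order) auto
    also have "(\<Sum>i=1..A. (s + t) / (of_nat i + of_nat B)) = (s + t) * h"
      using sum_inverse_add by (simp add: h_def divide_inverse flip: sum_distrib_left)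
    finally show ?thesis by (simp add: d0_def)
  qed
  have E: "pcong p 2 E (d0 * (1 + of_nat p * (- h)))"
  proof -
    have "E = (\<Prod>i=1..A. (of_nat i + of_nat B) + of_nat p * (- 1))"
      unfolding E_def by (intro prod.cong) (auto simp: algebra_simps)
    also have "pcong p 2 \<dots> ((\<Prod>i=1..A. of_nat i + of_nat B)
        * (1 + of_nat p * (\<Sum>i=1..A. - 1 / (of_nat i + of_nat B))))"
      using unit_plus by (intro pcong_prod_first_order) auto
    also have "(\<Sum>i=1..A. - 1 / (of_nat i + of_nat B)) = - h"
      using sum_inverse_add by (simp add: h_def sum_negf)
    finally show ?thesis by (simp add: d0_def)
  qed
  have D_unit: "zp_unit p D" unfolding D_def by (intro zp_unit_prod shift_unit) auto
  have E_unit: "zp_unit p E" unfolding E_def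
  proof (rule zp_unit_prod)
    fix i assume "i \<in> {1..A}"
    hence "zp_unit p (- of_nat (p - (i + B)))"
      using AB by (intro zp_unit_uminus zp_unit_nat_less) auto
    thus "zp_unit p (of_nat i + of_nat B - of_nat p)"
      using \<open>i \<in> {1..A}\<close> AB by (simp add: of_nat_diff algebra_simps)
  qed
  have n0Z: "n0 \<in> Zp p" unfolding n0_def by (intro Zp_prod) auto
  have d0Z: "d0 \<in> Zp p" unfolding d0_def by (intro Zp_prod) auto
  have ratio: "of_nat ((B - 1) choose A) / of_nat ((p - 1 - B) choose A) = n0 / E"
  proof -
    have "of_nat ((B - 1) choose A) / of_nat ((p - 1 - B) choose A)
        = (fact A * of_nat ((B - 1) choose A)) / (fact A * of_nat ((p - 1 - B) choose A) :: rat)"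
      by simp
    also have "\<dots> = (\<Prod>i=1..A. (of_nat (B - 1) + 1 - of_nat i) / (of_nat (p - 1 - B) + 1 - of_nat i))"
      by (simp only: fact_mult_binomial prod_dividef)
    also have "\<dots> = (\<Prod>i=1..A. (of_nat i - of_nat B) / (of_nat i + of_nat B - of_nat p))"
    proof (intro prod.cong refl)
      fix i
      have "(of_nat (B - 1) + 1 - of_nat i) / (of_nat (p - 1 - B) + 1 - of_nat i)
          = (- (of_nat i - of_nat B) / - (of_nat i + of_nat B - of_nat p) :: rat)"
        using B_pos AB by (simp add: of_nat_diff algebra_simps)
      thus "(of_nat (B - 1) + 1 - of_nat i) / (of_nat (p - 1 - B) + 1 - of_nat i)
          = ((of_nat i - of_nat B) / (of_nat i + of_nat B - of_nat p) :: rat)"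
        by (simp only: minus_divide_divide)
    qed
    finally show ?thesis by (simp add: n0_def E_def prod_dividef)
  qed
  have R: "R = M * (n0 / E) * (1 + of_nat p * X)"
    unfolding R_def ratio M_def X_def by (simp add: algebra_simps)
  have MZ: "M \<in> Zp p" unfolding M_def by (rule prefactor_Zp)
  show "R \<in> Zp p" unfolding R using MZ n0Z E_unit XZ by auto
  have BB: "harmonic B = harmonic (B - 1) + 1 / of_nat B"
  proof -
    obtain B' where "B = Suc B'" using B_pos by (cases B) auto
    thus ?thesis by (simp add: harmonic_def)
  qed
  \<comment> \<open>Precision \<open>p\<close> is enough here because the reciprocals occur only
    inside the coefficient of \<open>p\<close>.\<close>
  have inv_b: "pcong p 1 (1 / of_nat B) (1 / b)"
    by (intro pcong_inverse pcong_sym[OF b_cong] b_unit zp_unit_nat_less) (use B_pos AB in auto)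
  obtain z where z: "z \<in> Zp p" "1 / of_nat B - 1 / b = of_nat p * z"
    using inv_b by (auto simp: pcong_def)
  text \<open>The two sides agree to first order because \<open>1 / B\<close> and \<open>1 / b\<close> agree modulo \<open>p\<close>.\<close>
  have first_order: "(t - s) * e - h - t / b - ((s + t) * h + X) = of_nat p * ((s + t + 1) * z)"
  proof -
    have "(t - s) * e - h - t / b - ((s + t) * h + X) = (s + t + 1) * (1 / of_nat B - 1 / b)"
      unfolding e_def h_def X_def BB by (simp add: add_divide_distrib algebra_simps)
    thus ?thesis unfolding z(2) by (simp add: mult_ac)
  qed
  \<comment> \<open>Cross-multiplied by \<open>D * E\<close>, the claim involves only products
    already expanded; both are units and are divided out afterwards.\<close>
  have "pcong p 2 (N * E * (1 - of_nat p * t / b)) (D * n0 * (1 + of_nat p * X))"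
  proof -
    define \<alpha> \<beta> where "\<alpha> = (t - s) * e" and "\<beta> = (s + t) * h"
    have \<alpha>: "\<alpha> \<in> Zp p" and \<beta>: "\<beta> \<in> Zp p" unfolding \<alpha>_def \<beta>_def using s t eZ hhZ by auto
    have tb: "t / b \<in> Zp p" "of_nat p * t / b \<in> Zp p" using t b_unit by auto
    have DZ: "D \<in> Zp p" "E \<in> Zp p" using D_unit E_unit zp_unit_Zp by auto
    have "pcong p 2 (N * E * (1 - of_nat p * t / b))
        (n0 * (1 + of_nat p * \<alpha>) * (d0 * (1 + of_nat p * (- h))) * (1 - of_nat p * t / b))"
      using DZ n0Z d0Z \<alpha> hhZ tb N E unfolding \<alpha>_def[symmetric]
      by (intro pcong_mult pcong_refl) auto
    also have "pcong p 2 \<dots> (d0 * (1 + of_nat p * \<beta>) * n0 * (1 + of_nat p * X))"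
    proof -
      define \<tau> where "\<tau> = t / b"
      have fo: "\<alpha> - h - \<tau> - (\<beta> + X) = of_nat p * ((s + t + 1) * z)"
        using first_order by (simp add: \<alpha>_def \<beta>_def \<tau>_def)
      \<comment> \<open>The zeroth-order terms cancel. The difference is sorted by powers of
        \<open>p\<close> so that \<open>fo\<close> supplies the second factor \<open>p\<close> in
        the linear part.\<close>
      have "n0 * (1 + of_nat p * \<alpha>) * (d0 * (1 + of_nat p * (- h))) * (1 - of_nat p * \<tau>)
          - d0 * (1 + of_nat p * \<beta>) * n0 * (1 + of_nat p * X)
          = n0 * d0 * (of_nat p * (\<alpha> - h - \<tau> - (\<beta> + X)) + of_nat p ^ 2 *
             (\<tau> * h - \<alpha> * h - \<alpha> * \<tau> - \<beta> * X + of_nat p * (\<alpha> * h * \<tau>)))"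
        by (simp add: algebra_simps power2_eq_square)
      also have "\<dots> = of_nat p ^ 2 * (n0 * d0 * ((s + t + 1) * z
          + (\<tau> * h - \<alpha> * h - \<alpha> * \<tau> - \<beta> * X + of_nat p * (\<alpha> * h * \<tau>))))"
        unfolding fo by (simp add: algebra_simps power2_eq_square)
      finally have "pcong p 2 (n0 * (1 + of_nat p * \<alpha>) * (d0 * (1 + of_nat p * (- h))) * (1 - of_nat p * \<tau>))
          (d0 * (1 + of_nat p * \<beta>) * n0 * (1 + of_nat p * X))"
        by (rule pcongI) (use n0Z d0Z s t z(1) \<alpha> \<beta> hhZ XZ tb(1)[folded \<tau>_def] in auto)
      thus ?thesis by (simp add: \<tau>_def)
    qed
    also have "pcong p 2 \<dots> (D * n0 * (1 + of_nat p * X))"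
      using n0Z XZ DZ pcong_sym[OF D] unfolding \<beta>_def[symmetric]
      by (intro pcong_mult pcong_refl) auto
    finally show ?thesis .
  qed
  hence "pcong p 2 (M / (D * E) * (N * E * (1 - of_nat p * t / b)))
      (M / (D * E) * (D * n0 * (1 + of_nat p * X)))"
    by (rule pcong_scale) (intro Zp_divide MZ zp_unit_mult D_unit E_unit)
  moreover have "M / (D * E) * (N * E * (1 - of_nat p * t / b)) = N / D * (M * (1 - of_nat p * t / b))"
    "M / (D * E) * (D * n0 * (1 + of_nat p * X)) = R"
    unfolding R using zp_unit_nonzero[OF D_unit] zp_unit_nonzero[OF E_unit] by simp_all
  ultimately show "pcong p 2 (F a) R"
    using pcong_trans[OF F_a[folded N_def D_def M_def]] by simp
qed

end

theorem theorem2p1: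
  fixes p A B :: nat and a b s t :: rat
  assumes "prime p" and "odd p"
    and "a \<in> Zp p" and "b \<in> Zp p"
    and "\<not> zp_cong p p (a * b) 0"
    and "A = zp_residue p a" and "B = zp_residue p b"
    and "B \<le> p - 1 - A"
    and "t = (a - of_nat A) / of_nat p"
    and "s = (b - of_nat B) / of_nat p"
    and "\<not> zp_cong p p s (- 1)"
  shows "(B \<le> A \<longrightarrow>
           zp_cong p (p ^ 2)
             (\<Sum>k=0..p - 1. (a gchoose k) * ((- 1 - a) gchoose k) * (1 / (of_nat k + b)))
             (of_nat p * (s + t + 1) * (s - t) /
               (b ^ 2 * (s + 1) * of_nat (A choose B) * of_nat ((p - 1 - A) choose B)))) \<and>
         (B > A \<longrightarrow>
           zp_cong p (p ^ 2)
             (\<Sum>k=0..p - 1. (a gchoose k) * ((- 1 - a) gchoose k) * (1 / (of_nat k + b)))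
             ((s + 1 + t) / (b * (s + 1)) *
               (of_nat ((B - 1) choose A) / of_nat ((p - 1 - B) choose A)) *
               (1 + of_nat p * ((s + 1) / b)
                  + of_nat p * (2 * s + 1) * harmonic (B - 1)
                  - of_nat p * (s - t) * harmonic (B - A - 1)
                  - of_nat p * (s + t + 1) * harmonic (A + B))))"
proof -
  interpret padic_integers p by unfold_locales fact
  have A: "A < p" "pcong p 1 a (of_nat A)" and B: "pcong p 1 b (of_nat B)"
    using zp_residue_props[OF assms(3)] zp_residue_props[OF assms(4)] assms(6,7) by simp_all
  have quotient: "(x - of_nat n) / of_nat p \<in> Zp p" if x: "pcong p 1 x (of_nat n)" for x n
  proof -
    obtain z where "z \<in> Zp p" "x - of_nat n = of_nat p * z" using x by (auto simp: pcong_def)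
    thus ?thesis using p_gt_0 by simp
  qed
  have "\<not> pcong p 1 (a * b) 0" using assms(5) zp_cong_iff[of 1] by simp
  \<comment> \<open>If \<open>p\<close> divided \<open>b\<close>, it would also divide
    \<open>a * b\<close>. This later forces \<open>B\<close> to be positive.\<close>
  hence b0: "\<not> pcong p 1 b 0" using pcong_scale[of 1 b 0 a] assms(3) by auto
  have s: "s \<in> Zp p" and t: "t \<in> Zp p" using quotient A(2) B assms(9,10) by auto
  have "\<not> pcong p 1 s (- 1)" using assms(11) zp_cong_iff[of 1] by simp
  hence "\<not> pcong p 1 (1 + s) 0" using pcong_diff[OF _ pcong_refl, of 1 "1 + s" 0 1] by auto
  hence s1: "zp_unit p (1 + s)" using s by (simp add: zp_unit_iff)
  have "0 < B" using B b0 by (auto intro!: gr0I)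
  \<comment> \<open>Since \<open>A < p\<close>, the truncated subtraction in
    \<open>p - 1 - A\<close> is exact, and the bound on \<open>B\<close> becomes
    \<open>A + B < p\<close>.\<close>
  interpret residue_data p A B a b s t
    by unfold_locales (use assms s t s1 \<open>0 < B\<close> A p_gt_0 in auto)
  have F: "F a = (\<Sum>k=0..p - 1. (a gchoose k) * ((- 1 - a) gchoose k) * (1 / (of_nat k + b)))"
    by (simp add: F_def)
  show ?thesis unfolding F[symmetric]
    using F_a_le F_a_gt by (simp add: zp_cong_iff)
qed

end
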